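(* Let $N$ be a Nijenhuis operator on an anti-pre-Lie algebra $(A,\cdot)$. Put $\Omega(x,y)=x\cdot_N y= x\cdot N(y)+N(x)\cdot y-N(x\cdot y)$ for $x,y\in A$. Then $\Omega$ generates a linear deformation $(A,\cdot_t)$, $x\cdot_t y=x\cdot y+t\,\Omega(x,y)$, of the anti-pre-Lie algebra $(A,\cdot)$. Furthermore, this linear deformation is trivial.
   Context: All vector spaces are over a field $\mathbb K$. An anti-pre-Lie algebra is a vector space $A$ with a bilinear product $\cdot$ such that for all $x,y,z\in A$, with $[x,y]=x\cdot y-y\cdot x$: (1) $x\cdot(y\cdot z)-y\cdot(x\cdot z)=[y,x]\cdot z$; (2) $[x,y]\cdot z+[y,z]\cdot x+[z,x]\cdot y=0$. A linear map $N:A\to A$ is a Nijenhuis operator on $(A,\cdot)$ if $N(x)\cdot N(y)=N(x\cdot_N y)$ for all $x,y\in A$, where $x\cdot_N y:=x\cdot N(y)+N(x)\cdot y-N(x\cdot y)$. A linear map $\Omega:A\otimes A\to A$ generates a linear deformation of $(A,\cdot)$ if, for every parameter $t$, the product $x\cdot_t y=x\cdot y+t\,\Omega(x,y)$ makes $A$ an anti-pre-Lie algebra. Two linear deformations $\cdot_t$ and $\cdot'_t$ of $(A,\cdot)$ (generated by $\Omega$ and $\Omega'$) are equivalent if there is a linear map $N:A\to A$ such that for all $t$, $\mathrm{Id}_A+tN$ is a homomorphism from $(A,\cdot'_t)$ to $(A,\cdot_t)$, i.e. $(\mathrm{Id}_A+tN)(x\cdot'_t y)=(\mathrm{Id}_A+tN)(x)\cdot_t(\mathrm{Id}_A+tN)(y)$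 for all $x,y\in A$. A linear deformation $(A,\cdot_t)$ is trivial if it is equivalent to $(A,\cdot)$, meaning that there is a linear map $N:A\to A$ such that for all $t$, $\mathrm{Id}_A+tN$ is a homomorphism from $(A,\cdot_t)$ to $(A,\cdot)$. *)

theory Defs
  imports Complex_Main
begin

definition bilinear_op ::
  "('k::field \<Rightarrow> 'a::ab_group_add \<Rightarrow> 'a) \<Rightarrow> ('a \<Rightarrow> 'a \<Rightarrow> 'a) \<Rightarrow> bool" where
  "bilinear_op scale f \<longleftrightarrow>
     (\<forall>x. Vector_Spaces.linear scale scale (\<lambda>y. f x y)) \<and>
     (\<forall>y. Vector_Spaces.linear scale scale (\<lambda>x. f x y))"

definition commutator :: "('a::ab_group_add \<Rightarrow> 'a \<Rightarrow> 'a) \<Rightarrow> 'a \<Rightarrow> 'a \<Rightarrow> 'a" where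
  "commutator mul x y = mul x y - mul y x"

text \<open>The underlying vector space is the whole type \<open>'a\<close> with scalar multiplication \<open>scale\<close>.\<close>

locale anti_pre_lie_algebra = vector_space scale
  for scale :: "'k::field \<Rightarrow> 'a::ab_group_add \<Rightarrow> 'a" +
  fixes mul :: "'a \<Rightarrow> 'a \<Rightarrow> 'a"
  assumes bilinear: "bilinear_op scale mul"
    and anti_left_symmetric:
      "mul x (mul y z) - mul y (mul x z) = mul (commutator mul y x) z"
    and commutator_cyclic:
      "mul (commutator mul x y) z + mul (commutator mul y z) x + mul (commutator mul z x) y = 0"

definition algebra_hom ::
  "('k::field \<Rightarrow> 'a::ab_group_add \<Rightarrow> 'a) \<Rightarrow> ('a \<Rightarrow> 'a \<Rightarrow> 'a) \<Rightarrow> ('a \<Rightarrow> 'a \<Rightarrow> 'a) \<Rightarrow> ('a \<Rightarrow> 'a) \<Rightarrow> bool" where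
  "algebra_hom scale mul1 mul2 \<phi> \<longleftrightarrow>
     Vector_Spaces.linear scale scale \<phi> \<and> (\<forall>x y. \<phi> (mul1 x y) = mul2 (\<phi> x) (\<phi> y))"

definition nijenhuis_product ::
  "('a::ab_group_add \<Rightarrow> 'a \<Rightarrow> 'a) \<Rightarrow> ('a \<Rightarrow> 'a) \<Rightarrow> 'a \<Rightarrow> 'a \<Rightarrow> 'a" where
  "nijenhuis_product mul N x y = mul x (N y) + mul (N x) y - N (mul x y)"

definition nijenhuis_operator ::
  "('k::field \<Rightarrow> 'a::ab_group_add \<Rightarrow> 'a) \<Rightarrow> ('a \<Rightarrow> 'a \<Rightarrow> 'a) \<Rightarrow> ('a \<Rightarrow> 'a) \<Rightarrow> bool" where
  "nijenhuis_operator scale mul N \<longleftrightarrow>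
     Vector_Spaces.linear scale scale N \<and>
     (\<forall>x y. mul (N x) (N y) = N (nijenhuis_product mul N x y))"

definition deformed_product ::
  "('k::field \<Rightarrow> 'a::ab_group_add \<Rightarrow> 'a) \<Rightarrow> ('a \<Rightarrow> 'a \<Rightarrow> 'a) \<Rightarrow> ('a \<Rightarrow> 'a \<Rightarrow> 'a) \<Rightarrow> 'k \<Rightarrow> 'a \<Rightarrow> 'a \<Rightarrow> 'a" where
  "deformed_product scale mul \<Omega> t x y = mul x y + scale t (\<Omega> x y)"

text \<open>A linear map from \<open>A \<otimes> A\<close> to \<open>A\<close> is given as a bilinear map in two arguments.\<close>

definition generates_linear_deformation ::
  "('k::field \<Rightarrow> 'a::ab_group_add \<Rightarrow> 'a) \<Rightarrow> ('a \<Rightarrow> 'a \<Rightarrow> 'a) \<Rightarrow> ('a \<Rightarrow> 'a \<Rightarrow> 'a) \<Rightarrow> bool" where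
  "generates_linear_deformation scale mul \<Omega> \<longleftrightarrow>
     bilinear_op scale \<Omega> \<and>
     (\<forall>t. anti_pre_lie_algebra scale (deformed_product scale mul \<Omega> t))"

text \<open>The homomorphisms go from the deformation generated by \<open>\<Omega>'\<close> to the one generated by
  \<open>\<Omega>\<close>; they are not required to be invertible, so this relation is directed.\<close>

definition equivalent_linear_deformations ::
  "('k::field \<Rightarrow> 'a::ab_group_add \<Rightarrow> 'a) \<Rightarrow> ('a \<Rightarrow> 'a \<Rightarrow> 'a) \<Rightarrow>
   ('a \<Rightarrow> 'a \<Rightarrow> 'a) \<Rightarrow> ('a \<Rightarrow> 'a \<Rightarrow> 'a) \<Rightarrow> bool" where
  "equivalent_linear_deformations scale mul \<Omega>' \<Omega> \<longleftrightarrow>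
     generates_linear_deformation scale mul \<Omega>' \<and>
     generates_linear_deformation scale mul \<Omega> \<and>
     (\<exists>N. Vector_Spaces.linear scale scale N \<and>
       (\<forall>t. algebra_hom scale (deformed_product scale mul \<Omega>' t) (deformed_product scale mul \<Omega> t)
              (\<lambda>x. x + scale t (N x))))"

text \<open>The undeformed algebra is the linear deformation generated by the zero map.\<close>

definition trivial_linear_deformation ::
  "('k::field \<Rightarrow> 'a::ab_group_add \<Rightarrow> 'a) \<Rightarrow> ('a \<Rightarrow> 'a \<Rightarrow> 'a) \<Rightarrow> ('a \<Rightarrow> 'a \<Rightarrow> 'a) \<Rightarrow> bool" where
  "trivial_linear_deformation scale mul \<Omega> \<longleftrightarrow>
     equivalent_linear_deformations scale mul \<Omega> (\<lambda>x y. 0)"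

end

(* For a trilinear monomial T in the product (such as x(yz) or (xy)z), let T_t be the same monomial
   in the deformed product.  The Nijenhuis identity gives
     T_t = T + t D1 T + t^2 D2 T,
     D1 T = T(Nx,y,z) + T(x,Ny,z) + T(x,y,Nz) - N T(x,y,z),
     D2 T = T(Nx,Ny,z) + T(Nx,y,Nz) + T(x,Ny,Nz)
            - N (T(Nx,y,z) + T(x,Ny,z) + T(x,y,Nz)) + N (N T(x,y,z)).
   The right-hand side is linear in T and commutes with permutations of the arguments, so every
   trilinear identity of the algebra is inherited by the deformed product. *)

theory Submission
  imports Defs
begin

text \<open>Separates what holds for every bilinear product with a Nijenhuis operator; the
  anti-pre-Lie laws enter only when they are transferred at the end.\<close>

locale nijenhuis_bilinear = vector_space scale
  for scale :: "'k::field \<Rightarrow> 'a::ab_group_add \<Rightarrow> 'a" +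
  fixes mul :: "'a \<Rightarrow> 'a \<Rightarrow> 'a" and N :: "'a \<Rightarrow> 'a"
  assumes bilinear: "bilinear_op scale mul"
    and nijenhuis: "nijenhuis_operator scale mul N"
begin

abbreviation nij where "nij \<equiv> nijenhuis_product mul N"
abbreviation deformed where "deformed \<equiv> deformed_product scale mul nij"

lemma linear_N: "Vector_Spaces.linear scale scale N"
  using nijenhuis by (simp add: nijenhuis_operator_def)

sublocale N: Vector_Spaces.linear scale scale N
  by (rule linear_N)

sublocale mul_right: Vector_Spaces.linear scale scale "\<lambda>y. mul x y" for x
  using bilinear by (simp add: bilinear_op_def)

sublocale mul_left: Vector_Spaces.linear scale scale "\<lambda>x. mul x y" for y
  using bilinear by (simp add: bilinear_op_def)

lemmas mul_simps =
  N.add N.diff N.scale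
  mul_right.add mul_right.diff mul_right.scale
  mul_left.add mul_left.diff mul_left.scale
  scale_right_distrib scale_right_diff_distrib

lemma mul_N_N: "mul (N x) (N y) = N (nij x y)"
  using nijenhuis by (simp add: nijenhuis_operator_def)

lemma linear_endoI:
  assumes "\<And>x y. f (x + y) = f x + f y" "\<And>c x. f (scale c x) = scale c (f x)"
  shows "Vector_Spaces.linear scale scale f"
  using assms by unfold_locales auto

lemma bilinear_nij: "bilinear_op scale nij"
  unfolding bilinear_op_def
  by (intro conjI allI linear_endoI)
    (simp_all add: nijenhuis_product_def mul_simps algebra_simps)

lemma bilinear_deformed: "bilinear_op scale (deformed t)"
  unfolding bilinear_op_def
  by (intro conjI allI linear_endoI)
    (simp_all add: deformed_product_def nijenhuis_product_def mul_simps algebra_simps)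

definition prolong1 :: "('a \<Rightarrow> 'a \<Rightarrow> 'a \<Rightarrow> 'a) \<Rightarrow> 'a \<Rightarrow> 'a \<Rightarrow> 'a \<Rightarrow> 'a" where
  "prolong1 T x y z = T (N x) y z + T x (N y) z + T x y (N z) - N (T x y z)"

definition prolong2 :: "('a \<Rightarrow> 'a \<Rightarrow> 'a \<Rightarrow> 'a) \<Rightarrow> 'a \<Rightarrow> 'a \<Rightarrow> 'a \<Rightarrow> 'a" where
  "prolong2 T x y z = T (N x) (N y) z + T (N x) y (N z) + T x (N y) (N z)
     - N (T (N x) y z + T x (N y) z + T x y (N z)) + N (N (T x y z))"

text \<open>For trilinear \<open>T\<close> these are the terms up to t^2 of the formal power series
  (Id + tN)^(-1) T((Id + tN)x, (Id + tN)y, (Id + tN)z). Admitting any ternary function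
  \<open>T\<close>, not only a monomial, lets a whole identity be prolonged at once.\<close>

definition prolong :: "'k \<Rightarrow> ('a \<Rightarrow> 'a \<Rightarrow> 'a \<Rightarrow> 'a) \<Rightarrow> 'a \<Rightarrow> 'a \<Rightarrow> 'a \<Rightarrow> 'a" where
  "prolong t T x y z = T x y z + scale t (prolong1 T x y z) + scale (t * t) (prolong2 T x y z)"

lemmas prolong_defs = prolong_def prolong1_def prolong2_def

lemma prolong_zero: "prolong t (\<lambda>x y z. 0) x y z = 0"
  by (simp add: prolong_defs N.zero)

lemma prolong_add:
  "prolong t (\<lambda>x y z. S x y z + T x y z) x y z = prolong t S x y z + prolong t T x y z"
  by (simp add: prolong_defs mul_simps algebra_simps)

lemma prolong_diff:
  "prolong t (\<lambda>x y z. S x y z - T x y z) x y z = prolong t S x y z - prolong t T x y z"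
  by (simp add: prolong_defs mul_simps algebra_simps)

text \<open>Both coefficients sum over all placements of \<open>N\<close> in the argument slots, so
  permuting the slots only reorders the summands.\<close>

lemma prolong_swap: "prolong t (\<lambda>x y z. T y x z) x y z = prolong t T y x z"
  by (simp add: prolong_defs mul_simps algebra_simps)

lemma prolong_rotate: "prolong t (\<lambda>x y z. T y z x) x y z = prolong t T y z x"
  by (simp add: prolong_defs mul_simps algebra_simps)

text \<open>Compare powers of t: the linear coefficient needs only bilinearity, the quadratic one
  uses the Nijenhuis identity twice.\<close>

lemma deformed_right_nested:
  "deformed t x (deformed t y z) = prolong t (\<lambda>x y z. mul x (mul y z)) x y z"
proof -
  have 1: "nij x (mul y z) + mul x (nij y z) = prolong1 (\<lambda>x y z. mul x (mul y z)) x y z"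
    by (simp add: prolong1_def nijenhuis_product_def mul_simps algebra_simps)
  \<comment> \<open>First use: \<open>N (nij y z)\<close> becomes
    \<open>mul (N y) (N z)\<close>.\<close>
  have "nij x (nij y z) = mul x (mul (N y) (N z)) + mul (N x) (mul y (N z) + mul (N y) z)
      - mul (N x) (N (mul y z)) - N (mul x (nij y z))"
    by (subst nijenhuis_product_def, subst mul_N_N)
      (simp add: nijenhuis_product_def mul_simps algebra_simps)
  \<comment> \<open>Second use, on the pair \<open>x\<close>, \<open>mul y z\<close>: it yields the
    \<open>N (N T)\<close> term, and the two terms \<open>N (mul x (N (mul y z)))\<close>
    cancel.\<close>
  also have "\<dots> = prolong2 (\<lambda>x y z. mul x (mul y z)) x y z"
    by (simp add: mul_N_N[of x "mul y z"] prolong2_def nijenhuis_product_def[of _ _ x]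
        nijenhuis_product_def[of _ _ y] mul_simps algebra_simps)
  finally have 2: "nij x (nij y z) = prolong2 (\<lambda>x y z. mul x (mul y z)) x y z" .
  have "bilinear_op scale nij" by (rule bilinear_nij)
  then interpret R: Vector_Spaces.linear scale scale "nij x"
    by (simp add: bilinear_op_def)
  show ?thesis
    unfolding prolong_def 1[symmetric] 2[symmetric]
    by (simp add: deformed_product_def R.add R.scale mul_simps algebra_simps)
qed

text \<open>Mirror image of the right-nested case, with the Nijenhuis identity applied to the pairs
  \<open>x\<close>, \<open>y\<close> and \<open>mul x y\<close>, \<open>z\<close>.\<close>

lemma deformed_left_nested:
  "deformed t (deformed t x y) z = prolong t (\<lambda>x y z. mul (mul x y) z) x y z"
proof -
  have 1: "nij (mul x y) z + mul (nij x y) z = prolong1 (\<lambda>x y z. mul (mul x y) z) x y z"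
    by (simp add: prolong1_def nijenhuis_product_def mul_simps algebra_simps)
  have "nij (nij x y) z = mul (mul (N x) (N y)) z + mul (mul x (N y) + mul (N x) y) (N z)
      - mul (N (mul x y)) (N z) - N (mul (nij x y) z)"
    by (subst nijenhuis_product_def, subst mul_N_N)
      (simp add: nijenhuis_product_def mul_simps algebra_simps)
  also have "\<dots> = prolong2 (\<lambda>x y z. mul (mul x y) z) x y z"
    by (simp add: mul_N_N[of "mul x y" z] prolong2_def nijenhuis_product_def[of _ _ x]
        nijenhuis_product_def[of _ _ "mul x y"] mul_simps algebra_simps)
  finally have 2: "nij (nij x y) z = prolong2 (\<lambda>x y z. mul (mul x y) z) x y z" .
  have "bilinear_op scale nij" by (rule bilinear_nij)
  then interpret L: Vector_Spaces.linear scale scale "\<lambda>u. nij u z"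
    by (simp add: bilinear_op_def)
  show ?thesis
    unfolding prolong_def 1[symmetric] 2[symmetric]
    by (simp add: deformed_product_def L.add L.scale mul_simps algebra_simps)
qed

lemma deformed_hom: "algebra_hom scale (deformed t) mul (\<lambda>x. x + scale t (N x))"
  unfolding algebra_hom_def
proof (intro conjI allI)
  show "Vector_Spaces.linear scale scale (\<lambda>x. x + scale t (N x))"
    by (rule linear_endoI) (simp_all add: mul_simps algebra_simps)
  \<comment> \<open>This is the coefficient of t, immediate from the definition of
    \<open>nij\<close>; the coefficient of t^2 is the Nijenhuis identity itself.\<close>
  have "scale t (nij x y) + scale t (N (mul x y))
      = scale t (mul x (N y)) + scale t (mul (N x) y)" for x y
    by (simp add: nijenhuis_product_def mul_simps algebra_simps)
  then show "deformed t x y + scale t (N (deformed t x y))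
      = mul (x + scale t (N x)) (y + scale t (N y))" for x y
    by (simp add: deformed_product_def mul_simps mul_N_N algebra_simps)
qed

end

lemma (in anti_pre_lie_algebra) anti_pre_lie_deformed:
  assumes "nijenhuis_operator scale mul N"
  shows "anti_pre_lie_algebra scale (deformed_product scale mul (nijenhuis_product mul N) t)"
proof -
  interpret nijenhuis_bilinear scale mul N
    by unfold_locales (fact bilinear, fact assms)
  let ?R = "\<lambda>x y z. mul x (mul y z)" and ?L = "\<lambda>x y z. mul (mul x y) z"
  have comm: "deformed t (commutator (deformed t) x y) z = prolong t ?L x y z - prolong t ?L y x z"
    for x y z
  proof -
    have "bilinear_op scale (deformed t)" by (rule bilinear_deformed)
    then interpret L: Vector_Spaces.linear scale scale "\<lambda>u. deformed t u z"
      by (simp add: bilinear_op_def)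
    show ?thesis by (simp add: commutator_def L.diff deformed_left_nested)
  qed
  let ?C = "\<lambda>x y z. mul (commutator mul x y) z"
  have C: "prolong t ?C x y z = prolong t ?L x y z - prolong t ?L y x z" for x y z
    by (simp add: commutator_def mul_left.diff prolong_diff prolong_swap[where T = ?L])
  show ?thesis
  proof
    fix x y z
    \<comment> \<open>The law of \<open>mul\<close> makes the two ternary functions equal, so their
      prolongations agree without any expansion.\<close>
    have "prolong t (\<lambda>x y z. ?R x y z - ?R y x z) x y z = prolong t (\<lambda>x y z. ?C y x z) x y z"
      by (simp add: anti_left_symmetric)
    then show "deformed t x (deformed t y z) - deformed t y (deformed t x z)
        = deformed t (commutator (deformed t) y x) z"
      by (simp only: deformed_right_nested comm C prolong_diff
          prolong_swap[where T = ?R] prolong_swap[where T = ?C])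
    have "prolong t (\<lambda>x y z. ?C x y z + ?C y z x + ?C z x y) x y z = 0"
      by (simp add: commutator_cyclic prolong_zero)
    \<comment> \<open>The second cyclic shift is the square of the first, hence two
      rotations.\<close>
    moreover have "prolong t (\<lambda>x y z. ?C z x y) x y z = prolong t ?C z x y"
      using prolong_rotate[where T = "\<lambda>x y z. ?C y z x"] prolong_rotate[where T = ?C]
      by simp
    ultimately show "deformed t (commutator (deformed t) x y) z
        + deformed t (commutator (deformed t) y z) x
        + deformed t (commutator (deformed t) z x) y = 0"
      by (simp only: comm C prolong_add prolong_rotate[where T = ?C])
  qed (fact bilinear_deformed)
qed

theorem theorem3p4:
  fixes scale :: "'k::field \<Rightarrow> 'a::ab_group_add \<Rightarrow> 'a"
    and mul :: "'a \<Rightarrow> 'a \<Rightarrow> 'a"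
    and N :: "'a \<Rightarrow> 'a"
    and \<Omega> :: "'a \<Rightarrow> 'a \<Rightarrow> 'a"
  assumes "anti_pre_lie_algebra scale mul"
    and "nijenhuis_operator scale mul N"
    and "\<And>x y. \<Omega> x y = nijenhuis_product mul N x y"
  shows "generates_linear_deformation scale mul \<Omega> \<and> trivial_linear_deformation scale mul \<Omega>"
proof -
  interpret A: anti_pre_lie_algebra scale mul by fact
  interpret B: nijenhuis_bilinear scale mul N
    by unfold_locales (fact A.bilinear, fact assms(2))
  have \<Omega>: "\<Omega> = nijenhuis_product mul N"
    using assms(3) by (intro ext)
  have zero: "deformed_product scale mul (\<lambda>x y. 0) t = mul" for t
    by (intro ext) (simp add: deformed_product_def)
  have gen: "generates_linear_deformation scale mul \<Omega>"
    using A.anti_pre_lie_deformed[OF assms(2)] B.bilinear_nij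
    by (simp add: generates_linear_deformation_def \<Omega>)
  have "bilinear_op scale (\<lambda>x y. 0)"
    unfolding bilinear_op_def by (intro conjI allI B.linear_endoI) simp_all
  then have "generates_linear_deformation scale mul (\<lambda>x y. 0)"
    using assms(1) by (simp add: generates_linear_deformation_def zero)
  \<comment> \<open>The Nijenhuis operator itself witnesses triviality; deforming by zero leaves
    \<open>mul\<close> as the target for every t.\<close>
  moreover have "\<forall>t. algebra_hom scale (deformed_product scale mul \<Omega> t)
      (deformed_product scale mul (\<lambda>x y. 0) t) (\<lambda>x. x + scale t (N x))"
    by (simp add: zero \<Omega> B.deformed_hom)
  ultimately have "trivial_linear_deformation scale mul \<Omega>"
    using gen B.linear_N
    unfolding trivial_linear_deformation_def equivalent_linear_deformations_def by blast
  with gen show ?thesis ..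
qed

end
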